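(* Let $A\in M(2n-1,\mathbb R)$ be nilpotent and let $\mathfrak g_A=\mathbb R e_0\ltimes_A\mathbb R^{2n-1}$ be the corresponding nilpotent almost abelian Lie algebra. If $\mathfrak g_A$ admits a complex structure, then $\mathfrak g_A$ admits a symplectic structure.
   Context: For $A\in M(d,\mathbb R)$, $\mathfrak g_A=\mathbb R e_0\ltimes_A\mathbb R^d$ denotes the $(d+1)$-dimensional real Lie algebra $\mathbb R e_0\oplus\mathbb R^d$ with $[e_0,v]=Av$ and $[v,w]=0$ for $v,w\in\mathbb R^d$ (an almost abelian Lie algebra); it is nilpotent if and only if $A$ is nilpotent. A complex structure on a real Lie algebra $\mathfrak g$ is a linear automorphism $j$ of the vector space $\mathfrak g$ with $j^2=-\mathrm{id}$ and $[x,y]+j([jx,y]+[x,jy])-[jx,jy]=0$ for all $x,y\in\mathfrak g$. A symplectic structure on $\mathfrak g$ is a non-degenerate 2-form $\omega$ on $\mathfrak g$ that is closed: $\omega([x,y],z)+\omega([y,z],x)+\omega([z,x],y)=0$ for all $x,y,z\in\mathfrak g$. *)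

theory Defs
  imports "HOL-Analysis.Analysis"
begin

(* Iterated matrix product: (^) on real^'d^'d is the componentwise power. *)
definition nilpotent_matrix :: "real^'d^'d \<Rightarrow> bool" where
  "nilpotent_matrix A \<longleftrightarrow> (\<exists>k. (((**) A) ^^ k) (mat 1) = 0)"

definition lie_bracket :: "('g::real_vector \<Rightarrow> 'g \<Rightarrow> 'g) \<Rightarrow> bool" where
  "lie_bracket br \<longleftrightarrow>
     bilinear br \<and> (\<forall>x. br x x = 0) \<and>
     (\<forall>x y z. br x (br y z) + br y (br z x) + br z (br x y) = 0)"

(* The vector space R e_0 + R^d is the product type real \<times> (real^'d), with e_0 = (1, 0) and
   R^d embedded as v \<mapsto> (0, v); the bracket below is the bilinear alternating extension of
   [e_0, v] = A v, [v, w] = 0. *)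
definition almost_abelian_bracket ::
  "real^'d^'d \<Rightarrow> real \<times> (real^'d) \<Rightarrow> real \<times> (real^'d) \<Rightarrow> real \<times> (real^'d)" where
  "almost_abelian_bracket A x y = (0, fst x *\<^sub>R (A *v snd y) - fst y *\<^sub>R (A *v snd x))"

lemma almost_abelian_bracket_e0: "almost_abelian_bracket A (1, 0) (0, v) = (0, A *v v)"
  by (simp add: almost_abelian_bracket_def)

lemma almost_abelian_bracket_abelian: "almost_abelian_bracket A (0, v) (0, w) = 0"
  by (simp add: almost_abelian_bracket_def zero_prod_def)

lemma lie_bracket_almost_abelian: "lie_bracket (almost_abelian_bracket A)"
  by (auto simp: lie_bracket_def bilinear_def almost_abelian_bracket_def zero_prod_def
      matrix_vector_mult_scaleR matrix_vector_right_distrib matrix_vector_mult_diff_distrib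
      algebra_simps intro!: linearI)

definition complex_structure :: "('g::real_vector \<Rightarrow> 'g \<Rightarrow> 'g) \<Rightarrow> ('g \<Rightarrow> 'g) \<Rightarrow> bool" where
  "complex_structure br j \<longleftrightarrow>
     linear j \<and> bij j \<and> (\<forall>x. j (j x) = - x) \<and>
     (\<forall>x y. br x y + j (br (j x) y + br x (j y)) - br (j x) (j y) = 0)"

definition symplectic_structure ::
  "('g::real_vector \<Rightarrow> 'g \<Rightarrow> 'g) \<Rightarrow> ('g \<Rightarrow> 'g \<Rightarrow> real) \<Rightarrow> bool" where
  "symplectic_structure br \<omega> \<longleftrightarrow>
     bilinear \<omega> \<and> (\<forall>x. \<omega> x x = 0) \<and>
     (\<forall>x. (\<forall>y. \<omega> x y = 0) \<longrightarrow> x = 0) \<and>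
     (\<forall>x y z. \<omega> (br x y) z + \<omega> (br y z) x + \<omega> (br z x) y = 0)"

end

theory Submission
  imports Defs
begin

text \<open>
  Write \<open>V\<close> for the abelian ideal and \<open>j\<close> for the complex structure. Integrability says that
  \<open>A\<close> commutes with \<open>j\<close> on \<open>V \<inter> jV\<close>, so \<open>A\<close> extends from \<open>V\<close> to a nilpotent
  complex-linear endomorphism \<open>N\<close> of the whole of \<open>V + jV\<close>, the Lie algebra. Splitting off
  complex cyclic submodules of maximal length, one finds a non-degenerate alternating form for which
  \<open>N\<close> is skew. Closedness of a 2-form only says that \<open>A\<close> is skew for its restriction to
  \<open>V\<close>, hence that form is symplectic.
\<close>

section \<open>Complex-linear endomorphisms and their powers\<close>

locale complex_linear_endomorphism =
  fixes A j :: "'a::euclidean_space \<Rightarrow> 'a"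
  assumes linear_A: "linear A"
    and linear_j: "linear j"
    and j_j: "j (j x) = - x"
    and A_j: "A (j x) = j (A x)"
begin

lemma linear_funpow: "linear (A ^^ k)"
proof (induction k)
  case 0
  show ?case
    by (simp add: linear_iff)
next
  case (Suc k)
  then show ?case
    using linear_compose[OF Suc linear_A] by (simp add: o_def)
qed

lemmas pow_simps =
  linear_add[OF linear_funpow] linear_diff[OF linear_funpow] linear_cmul[OF linear_funpow]
  linear_neg[OF linear_funpow] linear_0[OF linear_funpow] linear_sum[OF linear_funpow]

lemmas j_simps =
  linear_add[OF linear_j] linear_diff[OF linear_j] linear_cmul[OF linear_j]
  linear_neg[OF linear_j] linear_0[OF linear_j] linear_sum[OF linear_j]

lemmas A_simps =
  linear_add[OF linear_A] linear_diff[OF linear_A] linear_cmul[OF linear_A]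
  linear_neg[OF linear_A] linear_0[OF linear_A] linear_sum[OF linear_A]

lemma funpow_j: "(A ^^ k) (j x) = j ((A ^^ k) x)"
  by (induction k) (auto simp: A_j)

lemma funpow_funpow: "(A ^^ k) ((A ^^ l) x) = (A ^^ (k + l)) x"
  by (simp add: funpow_add)

lemma A_funpow: "A ((A ^^ l) x) = (A ^^ Suc l) x"
  by simp

lemma funpow_A: "(A ^^ l) (A x) = (A ^^ Suc l) x"
  by (simp add: funpow_swap1)

lemma funpow_eq_0_mono:
  assumes "(A ^^ k) x = 0" and "k \<le> l"
  shows "(A ^^ l) x = 0"
  using assms funpow_funpow[of "l - k" k x] by (simp add: pow_simps)

lemma exists_dual_functional:
  assumes "r \<noteq> 0"
  obtains \<phi> :: "'a \<Rightarrow> real" where "linear \<phi>" "\<phi> r = 1" "\<phi> (j r) = 0"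
proof -
  \<comment> \<open>The averaged inner product is \<open>j\<close>-invariant, so \<open>r\<close> and \<open>j r\<close> are orthogonal for it.\<close>
  define c where "c = r \<bullet> r + j r \<bullet> j r"
  define \<phi> where "\<phi> = (\<lambda>y. (y \<bullet> r + j y \<bullet> j r) / c)"
  have "c > 0"
    using assms by (auto simp: c_def intro: add_pos_nonneg)
  show thesis
  proof
    show "linear \<phi>"
      by (rule linearI) (simp_all add: \<phi>_def j_simps inner_add_left add_divide_distrib algebra_simps)
    show "\<phi> r = 1"
      using \<open>c > 0\<close> by (simp add: \<phi>_def c_def)
    show "\<phi> (j r) = 0"
      by (simp add: \<phi>_def j_j inner_commute)
  qed
qed

section \<open>Cyclic submodules and the construction of the skew form\<close>

text \<open>With \<open>j\<close> as multiplication by i, \<open>\<phi> y - i * \<phi> (j y)\<close>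
  is a complex-linear functional f, and the claim makes f dual to the end of the chain of
  \<open>x\<close>. A functional dual to \<open>(A ^^ m) x\<close> is corrected on the other chain
  vectors, for decreasing exponents.\<close>

lemma exists_cyclic_coordinate:
  assumes "(A ^^ m) x \<noteq> 0" and "(A ^^ Suc m) x = 0"
  obtains \<phi> :: "'a \<Rightarrow> real" where "linear \<phi>"
    "\<And>k. \<phi> ((A ^^ k) x) = (if k = m then 1 else 0)" "\<And>k. \<phi> (j ((A ^^ k) x)) = 0"
proof -
  have vanish: "(A ^^ k) x = 0" if "k > m" for k
    using funpow_eq_0_mono[OF assms(2)] that by simp
  have "\<exists>\<phi> :: 'a \<Rightarrow> real. linear \<phi> \<and>
          (\<forall>k. m \<le> k + i \<longrightarrow> \<phi> ((A ^^ k) x) = (if k = m then 1 else 0) \<and> \<phi> (j ((A ^^ k) x)) = 0)"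
    for i
  proof (induction i)
    case 0
    obtain \<phi> :: "'a \<Rightarrow> real"
      where \<phi>: "linear \<phi>" "\<phi> ((A ^^ m) x) = 1" "\<phi> (j ((A ^^ m) x)) = 0"
      using exists_dual_functional[OF assms(1)] .
    have "\<phi> ((A ^^ k) x) = (if k = m then 1 else 0) \<and> \<phi> (j ((A ^^ k) x)) = 0" if "m \<le> k" for k
      using \<phi> vanish[of k] that by (cases "k = m") (auto simp: j_simps linear_0)
    then show ?case
      using \<phi>(1) by auto
  next
    case (Suc i)
    then obtain \<phi> :: "'a \<Rightarrow> real" where lin: "linear \<phi>"
      and \<phi>1: "\<And>k. m \<le> k + i \<Longrightarrow> \<phi> ((A ^^ k) x) = (if k = m then 1 else 0)"
      and \<phi>2: "\<And>k. m \<le> k + i \<Longrightarrow> \<phi> (j ((A ^^ k) x)) = 0"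
      by blast
    show ?case
    proof (cases "m \<le> i")
      case True
      then show ?thesis
        using lin \<phi>1 \<phi>2 by (intro exI[of _ \<phi>]) auto
    next
      case False
      define l where "l = m - Suc i"
      have m: "m = l + Suc i"
        using False by (simp add: l_def)
      \<comment> \<open>Since \<open>Suc i + l = m\<close>, composing with \<open>A ^^ Suc i\<close>
        sends \<open>(A ^^ l) x\<close> to the end of the chain and kills all later vectors.
        Subtracting the right complex multiple thus repairs exponent \<open>l\<close> without
        disturbing higher ones; the plus sign reflects \<open>j (j x) = - x\<close>.\<close>
      define \<psi> where "\<psi> = (\<lambda>y. \<phi> y - \<phi> ((A ^^ l) x) * \<phi> ((A ^^ Suc i) y)
                                 + \<phi> (j ((A ^^ l) x)) * \<phi> (j ((A ^^ Suc i) y)))"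
      note \<phi>_simps = linear_add[OF lin] linear_cmul[OF lin] linear_neg[OF lin] linear_0[OF lin]
      have "linear \<psi>"
        by (rule linearI)
          (simp_all add: \<psi>_def \<phi>_simps j_simps pow_simps algebra_simps del: funpow.simps)
      moreover have "\<psi> ((A ^^ k) x) = (if k = m then 1 else 0) \<and> \<psi> (j ((A ^^ k) x)) = 0"
        if "m \<le> k + Suc i" for k
      proof (cases "k = l")
        case True
        then show ?thesis
          using \<phi>1[of m] \<phi>2[of m] m
          by (simp add: \<psi>_def funpow_funpow funpow_j j_j \<phi>_simps add.commute del: funpow.simps)
      next
        case False
        then have "m \<le> k + i" "Suc i + k > m"
          using that m by auto
        then show ?thesis
          using \<phi>1[of k] \<phi>2[of k] vanish[of "Suc i + k"]
          by (simp add: \<psi>_def funpow_funpow funpow_j j_j \<phi>_simps j_simps del: funpow.simps)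
      qed
      ultimately show ?thesis
        by blast
    qed
  qed
  from this[of m] show thesis
    using that by auto
qed

text \<open>A longest complex cyclic submodule has a complement stable under \<open>A\<close> and
  \<open>j\<close>, which allows induction on the dimension. Over the reals the cyclic summand is
  two copies of one Jordan block, and pairing one copy with the other gives a skew form for any
  block length.\<close>

lemma exists_skew_form_on:
  assumes "subspace S" and "\<And>y. y \<in> S \<Longrightarrow> A y \<in> S" and "\<And>y. y \<in> S \<Longrightarrow> j y \<in> S"
    and "\<And>y. y \<in> S \<Longrightarrow> (A ^^ N) y = 0"
  shows "\<exists>\<omega> :: 'a \<Rightarrow> 'a \<Rightarrow> real. bilinear \<omega> \<and> (\<forall>y. \<omega> y y = 0) \<and>
           (\<forall>y\<in>S. \<forall>z\<in>S. \<omega> (A y) z + \<omega> y (A z) = 0) \<and>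
           (\<forall>y\<in>S. (\<forall>z\<in>S. \<omega> y z = 0) \<longrightarrow> y = 0)"
  using assms
proof (induction "dim S" arbitrary: S rule: less_induct)
  case less
  note S = less.prems
  show ?case
  proof (cases "S \<subseteq> {0}")
    case True
    then show ?thesis
      by (intro exI[of _ "\<lambda>_ _. 0"]) (auto simp: bilinear_def linear_iff)
  next
    case False
    \<comment> \<open>\<open>x\<close> will start a chain of maximal length. Maximality means that
      \<open>A ^^ Suc m\<close> kills all of \<open>S\<close>, which removes the boundary terms of
      the shifted sums below.\<close>
    define M where "M = (LEAST n. \<forall>y\<in>S. (A ^^ n) y = 0)"
    have M: "\<forall>y\<in>S. (A ^^ M) y = 0"
      unfolding M_def by (rule LeastI[of _ N]) (use S(4) in blast)
    have "M \<noteq> 0"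
      using False M by (intro notI) auto
    then obtain m where m: "M = Suc m"
      using not0_implies_Suc by blast
    have "\<not> (\<forall>y\<in>S. (A ^^ m) y = 0)"
      using not_less_Least[of m "\<lambda>n. \<forall>y\<in>S. (A ^^ n) y = 0"] m unfolding M_def by auto
    then obtain x where x: "x \<in> S" "(A ^^ m) x \<noteq> 0"
      by blast
    have AS: "(A ^^ Suc m) y = 0" if "y \<in> S" for y
      using M m that by blast
    have AS': "(A ^^ k) y = 0" if "y \<in> S" "k > m" for y k
      using funpow_eq_0_mono[OF AS[OF that(1)]] that(2) by simp
    have powS: "(A ^^ k) y \<in> S" if "y \<in> S" for k y
      using that S(2) by (induction k) auto
    obtain \<phi> :: "'a \<Rightarrow> real" where lin: "linear \<phi>"
      and \<phi>1: "\<And>k. \<phi> ((A ^^ k) x) = (if k = m then 1 else 0)"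
      and \<phi>2: "\<And>k. \<phi> (j ((A ^^ k) x)) = 0"
      using exists_cyclic_coordinate[OF x(2) AS[OF x(1)]] by metis
    note \<phi>_simps = linear_add[OF lin] linear_diff[OF lin] linear_cmul[OF lin] linear_neg[OF lin]
      linear_0[OF lin] linear_sum[OF lin]
    \<comment> \<open>The common kernel of the functionals f o \<open>A ^^ k\<close>, where f y =
      \<open>\<phi> y - i * \<phi> (j y)\<close>; hence stable under \<open>A\<close> and
      \<open>j\<close>.\<close>
    define K where "K = {y \<in> S. \<forall>k. \<phi> ((A ^^ k) y) = 0 \<and> \<phi> (j ((A ^^ k) y)) = 0}"
    \<comment> \<open>The projection onto \<open>K\<close> along the cyclic submodule: f o
      \<open>A ^^ (m - k)\<close> reads off the complex coefficient of \<open>(A ^^ k) x\<close>,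
      and complex scalars act through \<open>j\<close>.\<close>
    define P where "P = (\<lambda>y. y - (\<Sum>k\<le>m. \<phi> ((A ^^ (m - k)) y) *\<^sub>R (A ^^ k) x
                                        - \<phi> (j ((A ^^ (m - k)) y)) *\<^sub>R j ((A ^^ k) x)))"
    have subK: "subspace K"
      using S(1) by (auto simp: K_def subspace_def \<phi>_simps j_simps pow_simps)
    have AK: "A y \<in> K" if "y \<in> K" for y
      using that S(2) by (auto simp: K_def funpow_A simp del: funpow.simps)
    have jK: "j y \<in> K" if "y \<in> K" for y
      using that S(3) by (auto simp: K_def funpow_j j_j \<phi>_simps)
    have "x \<notin> K"
      using \<phi>1[of m] unfolding K_def by force
    then have "K \<subset> S"
      using x(1) by (auto simp: K_def)
    then have "dim K < dim S"
      using subK S(1) by (metis dim_psubset span_eq_iff)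
    then have "\<exists>\<kappa> :: 'a \<Rightarrow> 'a \<Rightarrow> real. bilinear \<kappa> \<and> (\<forall>y. \<kappa> y y = 0) \<and>
           (\<forall>y\<in>K. \<forall>z\<in>K. \<kappa> (A y) z + \<kappa> y (A z) = 0) \<and>
           (\<forall>y\<in>K. (\<forall>z\<in>K. \<kappa> y z = 0) \<longrightarrow> y = 0)"
      by (rule less.hyps[OF _ subK AK jK]) (use S(4) \<open>K \<subset> S\<close> in auto)
    then obtain \<kappa> :: "'a \<Rightarrow> 'a \<Rightarrow> real" where bil\<kappa>: "bilinear \<kappa>" and alt\<kappa>: "\<And>y. \<kappa> y y = 0"
      and skew\<kappa>: "\<And>y z. y \<in> K \<Longrightarrow> z \<in> K \<Longrightarrow> \<kappa> (A y) z + \<kappa> y (A z) = 0"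
      and nondeg\<kappa>: "\<And>y. y \<in> K \<Longrightarrow> (\<And>z. z \<in> K \<Longrightarrow> \<kappa> y z = 0) \<Longrightarrow> y = 0"
      by blast

    have P_lin: "linear P"
      by (rule linearI) (simp_all add: P_def \<phi>_simps j_simps pow_simps sum.distrib
          sum_subtractf scaleR_sum_right algebra_simps)
    have PS: "P y \<in> K" if "y \<in> S" for y
    proof -
      have mem: "P y \<in> S"
        unfolding P_def using S(1) that x(1) powS S(3)
        by (intro subspace_diff subspace_sum subspace_scale) auto
      have "\<phi> ((A ^^ l) (P y)) = 0 \<and> \<phi> (j ((A ^^ l) (P y))) = 0" for l
      proof (cases "l \<le> m")
        case True
        \<comment> \<open>Only the summand \<open>k = m - l\<close> survives, and it cancels the
          value at \<open>y\<close>.\<close>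
        have iff: "l + k = m \<longleftrightarrow> k = m - l" for k
          using True by auto
        show ?thesis
          using True
          by (simp add: P_def \<phi>_simps j_simps pow_simps funpow_j funpow_funpow j_j \<phi>1 \<phi>2 iff
              if_distrib[of "\<lambda>t. _ * t"] if_distrib[of uminus] sum.delta cong: if_cong)
      next
        case False
        then show ?thesis
          using AS'[OF mem, of l] by (simp add: \<phi>_simps j_simps)
      qed
      then show ?thesis
        using mem by (auto simp: K_def)
    qed
    have P_K: "P y = y" if "y \<in> K" for y
      using that by (simp add: P_def K_def)
    have P_A: "P (A y) = A (P y)" if "y \<in> S" for y
    proof -
      \<comment> \<open>Both sides subtract the same sum up to an index shift; the end terms contain
        \<open>(A ^^ Suc m) y\<close> and \<open>(A ^^ Suc m) x\<close>, so they vanish.\<close>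
      define g where "g = (\<lambda>k. \<phi> ((A ^^ (Suc m - k)) y) *\<^sub>R (A ^^ k) x
                                - \<phi> (j ((A ^^ (Suc m - k)) y)) *\<^sub>R j ((A ^^ k) x))"
      have "P (A y) = A y - (\<Sum>k\<le>m. g k)"
        unfolding P_def g_def funpow_A
        by (intro arg_cong2[where f = "(-)"] sum.cong refl) (simp_all add: Suc_diff_le del: funpow.simps)
      moreover have "A (P y) = A y - (\<Sum>k\<le>m. g (Suc k))"
        unfolding P_def g_def
        by (simp add: A_simps A_j A_funpow del: funpow.simps)
      moreover have "(\<Sum>k\<le>Suc m. g k) = g 0 + (\<Sum>k\<le>m. g (Suc k))"
        by (rule sum.atMost_Suc_shift)
      moreover have "g 0 = 0"
        using AS[OF that] by (simp add: g_def \<phi>_simps j_simps del: funpow.simps)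
      moreover have "g (Suc m) = 0"
        using AS[OF x(1)] by (simp add: g_def \<phi>_simps j_simps del: funpow.simps)
      ultimately show ?thesis
        by simp
    qed
    have P_cyc: "P ((A ^^ l) x) = 0 \<and> P (j ((A ^^ l) x)) = 0" if "l \<le> m" for l
    proof -
      have iff: "m + l - k = m \<longleftrightarrow> k = l" if "k \<le> m" for k
        using that \<open>l \<le> m\<close> by auto
      show ?thesis
        using that
        by (simp add: P_def \<phi>_simps funpow_j funpow_funpow j_j \<phi>1 \<phi>2 iff sum_subtractf
            if_distrib[of "\<lambda>t. t *\<^sub>R _"] if_distrib[of uminus] sum.delta cong: if_cong)
    qed

    \<comment> \<open>Pairs the real part of f on \<open>y\<close> with the imaginary part on
      \<open>z\<close>; the alternating sign makes \<open>B (A y) z\<close> and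
      \<open>B y (A z)\<close> cancel after an index shift.\<close>
    define B where "B = (\<lambda>y z. \<Sum>k\<le>m. (-1) ^ k * (\<phi> ((A ^^ k) y) * \<phi> (j ((A ^^ (m - k)) z))))"
    have B_skew: "B (A y) z + B y (A z) = 0" if "y \<in> S" "z \<in> S" for y z
    proof -
      define h where "h = (\<lambda>k. (-1) ^ k * (\<phi> ((A ^^ k) y) * \<phi> (j ((A ^^ (Suc m - k)) z))))"
      have "B (A y) z = - (\<Sum>k\<le>m. h (Suc k))"
        unfolding B_def h_def funpow_A sum_negf[symmetric]
        by (intro sum.cong refl) (simp del: funpow.simps)
      moreover have "B y (A z) = (\<Sum>k\<le>m. h k)"
        unfolding B_def h_def funpow_A
        by (intro sum.cong refl) (simp add: Suc_diff_le del: funpow.simps)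
      moreover have "(\<Sum>k\<le>Suc m. h k) = h 0 + (\<Sum>k\<le>m. h (Suc k))"
        by (rule sum.atMost_Suc_shift)
      moreover have "h 0 = 0" "h (Suc m) = 0"
        using AS that by (simp_all add: h_def \<phi>_simps j_simps del: funpow.simps)
      ultimately show ?thesis
        by simp
    qed
    have B_x: "B y ((A ^^ l) x) = 0" "B (j ((A ^^ l) x)) y = 0" for y l
      by (simp_all add: B_def funpow_funpow funpow_j \<phi>2)
    have B_jx: "B y (j ((A ^^ l) x)) = - ((-1) ^ l * \<phi> ((A ^^ l) y))" if "l \<le> m" for y l
    proof -
      have iff: "m + l - k = m \<longleftrightarrow> k = l" if "k \<le> m" for k
        using that \<open>l \<le> m\<close> by auto
      show ?thesis
        using that
        by (simp add: B_def \<phi>_simps funpow_j funpow_funpow j_j \<phi>1 iff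
            if_distrib[of "\<lambda>t. _ * t"] if_distrib[of uminus] sum.delta cong: if_cong)
    qed
    have B_x': "B ((A ^^ l) x) y = (-1) ^ (m - l) * \<phi> (j ((A ^^ l) y))" if "l \<le> m" for y l
    proof -
      have iff: "k + l = m \<longleftrightarrow> k = m - l" for k
        using \<open>l \<le> m\<close> by auto
      show ?thesis
        using that
        by (simp add: B_def funpow_funpow \<phi>1 iff if_distrib[of "\<lambda>t. t * _"]
            if_distrib[of "\<lambda>t. _ * t"] sum.delta cong: if_cong)
    qed

    \<comment> \<open>\<open>B\<close> made alternating, plus the form on \<open>K\<close> pulled
      back along \<open>P\<close>, which commutes with \<open>A\<close> on \<open>S\<close>.\<close>
    define \<omega> where "\<omega> = (\<lambda>y z. B y z - B z y + \<kappa> (P y) (P z))"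
    have "bilinear \<omega>"
      unfolding bilinear_def
      by (intro conjI allI linearI)
        (simp_all add: \<omega>_def B_def \<phi>_simps j_simps pow_simps linear_add[OF P_lin]
          linear_cmul[OF P_lin] bilinear_ladd[OF bil\<kappa>] bilinear_radd[OF bil\<kappa>]
          bilinear_lmul[OF bil\<kappa>] bilinear_rmul[OF bil\<kappa>] sum.distrib sum_distrib_left algebra_simps)
    moreover have "\<omega> y y = 0" for y
      by (simp add: \<omega>_def alt\<kappa>)
    moreover have "\<omega> (A y) z + \<omega> y (A z) = 0" if "y \<in> S" "z \<in> S" for y z
      using B_skew[OF that] B_skew[OF that(2,1)] skew\<kappa>[OF PS PS, OF that] P_A that
      by (simp add: \<omega>_def)
    moreover have "y = 0" if "y \<in> S" and rad: "\<forall>z\<in>S. \<omega> y z = 0" for y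
    proof -
      note \<kappa>0 = bilinear_rzero[OF bil\<kappa>]
      \<comment> \<open>\<open>P\<close> kills the cyclic submodule, so pairing \<open>y\<close>
        with \<open>(A ^^ l) x\<close> and \<open>j ((A ^^ l) x)\<close> yields, up to sign, exactly
        these two values. Hence \<open>y\<close> lies in \<open>K\<close>, where the form reduces to
        \<open>\<kappa>\<close>.\<close>
      have "\<phi> ((A ^^ l) y) = 0 \<and> \<phi> (j ((A ^^ l) y)) = 0" for l
      proof (cases "l \<le> m")
        case True
        have "\<omega> y ((A ^^ l) x) = 0" "\<omega> y (j ((A ^^ l) x)) = 0"
          using rad powS[OF x(1)] S(3) by auto
        then show ?thesis
          using P_cyc[OF True] by (simp add: \<omega>_def B_x B_jx[OF True] B_x'[OF True] \<kappa>0)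
      next
        case False
        then show ?thesis
          using AS'[OF that(1), of l] by (simp add: \<phi>_simps j_simps)
      qed
      then have "y \<in> K"
        using that(1) by (auto simp: K_def)
      moreover have "\<kappa> y z = 0" if "z \<in> K" for z
      proof -
        have "\<omega> y z = 0"
          using rad \<open>K \<subset> S\<close> that by blast
        moreover have "B y z = 0" "B z y = 0"
          using \<open>y \<in> K\<close> by (simp_all add: B_def K_def)
        ultimately show ?thesis
          using P_K[OF that] P_K[OF \<open>y \<in> K\<close>] by (simp add: \<omega>_def)
      qed
      ultimately show "y = 0"
        by (rule nondeg\<kappa>)
    qed
    ultimately show ?thesis
      by (intro exI[of _ \<omega>]) blast
  qed
qed

end

section \<open>Passage between the Lie algebra and linear algebra\<close>

lemma complex_structure_imp_complex_linear_extension: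
  fixes A :: "real^'d^'d"
  assumes "complex_structure (almost_abelian_bracket A) j"
  obtains e :: "real \<times> (real^'d)" and N where "fst e = 1" "complex_linear_endomorphism N j"
    "\<And>v. fst v = 0 \<Longrightarrow> N v = (0, A *v snd v)"
    "\<And>y. \<exists>u v. fst u = 0 \<and> fst v = 0 \<and> y = u + j v"
proof -
  have lin: "linear j" and jj: "\<And>x. j (j x) = - x"
    and int: "\<And>x y. almost_abelian_bracket A x y
        + j (almost_abelian_bracket A (j x) y + almost_abelian_bracket A x (j y))
        - almost_abelian_bracket A (j x) (j y) = 0"
    using assms by (auto simp: complex_structure_def)
  note j_simps = linear_add[OF lin] linear_diff[OF lin] linear_cmul[OF lin] linear_neg[OF lin]
    linear_0[OF lin]
  \<comment> \<open>If the ideal were \<open>j\<close>-stable, \<open>j\<close> would induce a square root of \<open>-1\<close> on the real line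
      that is the quotient.\<close>
  have "\<exists>v. fst v = 0 \<and> fst (j v) \<noteq> 0"
  proof (rule ccontr)
    assume "\<not> ?thesis"
    then have stable: "fst (j v) = 0" if "fst v = 0" for v
      using that by blast
    define u :: "real \<times> (real^'d)" where "u = (1, 0)"
    define s where "s = fst (j u)"
    have u: "fst u = 1"
      by (simp add: u_def)
    have "fst (j (j u - s *\<^sub>R u)) = 0"
      by (rule stable) (simp add: s_def u)
    then have "- 1 - s * s = 0"
      by (simp add: j_simps jj s_def u)
    then show False
      using zero_le_square[of s] by linarith
  qed
  then obtain v where v: "fst v = 0" "fst (j v) \<noteq> 0"
    by blast
  \<comment> \<open>Rescaled so that \<open>e = j f\<close> has first coordinate 1 and can replace
    the standard \<open>e_0\<close>.\<close>
  define f where "f = (1 / fst (j v)) *\<^sub>R v"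
  define e where "e = j f"
  have f: "fst f = 0" and e: "fst e = 1"
    using v by (simp_all add: f_def e_def j_simps)
  have je: "j e = - f"
    by (simp add: e_def jj)
  define D :: "real \<times> (real^'d) \<Rightarrow> real \<times> (real^'d)" where "D = (\<lambda>y. (0, A *v snd y))"
  have D_lin: "linear D"
    by (rule linearI) (simp_all add: D_def matrix_vector_right_distrib matrix_vector_mult_scaleR)
  note D_simps = linear_add[OF D_lin] linear_diff[OF D_lin] linear_cmul[OF D_lin]
    linear_neg[OF D_lin] linear_0[OF D_lin]
  \<comment> \<open>Complex linearity forces the value \<open>j (D f)\<close> at
    \<open>e = j f\<close>; on the ideal \<open>N\<close> is \<open>D\<close>.\<close>
  define N where "N = (\<lambda>y. D (y - fst y *\<^sub>R e) + fst y *\<^sub>R j (D f))"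
  have N_lin: "linear N"
    by (rule linearI) (simp_all add: N_def D_simps algebra_simps)
  note N_simps = linear_add[OF N_lin] linear_diff[OF N_lin] linear_cmul[OF N_lin]
    linear_neg[OF N_lin]
  have N_V: "N y = D y" if "fst y = 0" for y
    using that by (simp add: N_def)
  have N_e: "N e = j (D f)"
    by (simp add: N_def e D_simps)
  have D_j: "D (j w) = j (D w)" if "fst w = 0" "fst (j w) = 0" for w
  proof -
    \<comment> \<open>As \<open>j e = - f\<close>, \<open>w\<close> and \<open>j w\<close> all lie
      in the ideal, two of the four brackets vanish.\<close>
    have "D w + j (D (j w)) = 0"
      using int[of e w] that f e
      by (simp add: almost_abelian_bracket_def je D_def zero_prod_def[symmetric])
    then have "j (D w + j (D (j w))) = 0"
      by (simp add: j_simps)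
    then show ?thesis
      by (simp add: j_simps jj)
  qed
  have N_j: "N (j y) = j (N y)" for y
  proof -
    \<comment> \<open>Since \<open>fst (j f) = 1\<close>, subtracting \<open>s *\<^sub>R f\<close>
      puts \<open>w\<close> into the intersection of the ideal with its image under
      \<open>j\<close>.\<close>
    define s where "s = fst (j (y - fst y *\<^sub>R e))"
    define w where "w = y - fst y *\<^sub>R e - s *\<^sub>R f"
    have y: "y = w + fst y *\<^sub>R e + s *\<^sub>R f"
      by (simp add: w_def)
    have w: "fst w = 0" "fst (j w) = 0"
      using e f by (simp_all add: w_def s_def j_simps je e_def[symmetric])
    have "N (j w) = j (N w)"
      using w by (simp add: N_V D_j)
    moreover have "N (j e) = j (N e)"
      by (simp add: je N_simps N_V f N_e jj)
    moreover have "N (j f) = j (N f)"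
      by (simp add: e_def[symmetric] N_e N_V f)
    ultimately show ?thesis
      by (subst (1 2) y) (simp only: N_simps j_simps)
  qed
  have "\<exists>u v. fst u = 0 \<and> fst v = 0 \<and> y = u + j v" for y
    using e f by (intro exI[of _ "y - fst y *\<^sub>R e"] exI[of _ "fst y *\<^sub>R f"])
      (simp add: j_simps e_def[symmetric])
  moreover have "complex_linear_endomorphism N j"
    by (rule complex_linear_endomorphism.intro) (rule N_lin lin jj N_j)+
  ultimately show thesis
    using that[of e N] e N_V by (simp add: D_def)
qed

text \<open>Split each argument along \<open>e\<close> and the ideal. In the cyclic sum the terms
  pairing with \<open>e\<close> cancel identically, and the others cancel because skewness makes
  \<omega>(Dv, w) symmetric on the ideal.\<close>

lemma symplectic_structure_of_skew_form:
  fixes A :: "real^'d^'d" and e :: "real \<times> (real^'d)"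
  assumes bil: "bilinear \<omega>" and alt: "\<And>x. \<omega> x x = 0"
    and nondeg: "\<And>x. (\<And>y. \<omega> x y = 0) \<Longrightarrow> x = 0"
    and e: "fst e = 1"
    and skew: "\<And>v w. fst v = 0 \<Longrightarrow> fst w = 0 \<Longrightarrow>
                 \<omega> (0, A *v snd v) w + \<omega> v (0, A *v snd w) = 0"
  shows "symplectic_structure (almost_abelian_bracket A) \<omega>"
proof -
  note \<omega>_simps = bilinear_ladd[OF bil] bilinear_radd[OF bil] bilinear_lmul[OF bil]
    bilinear_rmul[OF bil] bilinear_lsub[OF bil] bilinear_rsub[OF bil]
  have anti: "\<omega> x y = - \<omega> y x" for x y
    using alt[of "x + y"] unfolding \<omega>_simps by (simp add: alt)
  define D :: "real \<times> (real^'d) \<Rightarrow> real \<times> (real^'d)" where "D = (\<lambda>y. (0, A *v snd y))"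
  define p where "p = (\<lambda>y. y - fst y *\<^sub>R e)"
  have p: "fst (p y) = 0" and y: "y = p y + fst y *\<^sub>R e" for y
    using e by (simp_all add: p_def)
  have bracket: "almost_abelian_bracket A x y = fst x *\<^sub>R D (p y) - fst y *\<^sub>R D (p x)" for x y
    by (simp add: almost_abelian_bracket_def D_def p_def matrix_vector_mult_diff_distrib
        matrix_vector_mult_scaleR algebra_simps)
  have skew': "\<omega> (D (p x)) (p y) = \<omega> (D (p y)) (p x)" for x y
    using skew[OF p p, of x y] anti[of "p x" "D (p y)"] by (simp add: D_def)
  have expand: "\<omega> u z = \<omega> u (p z) + fst z * \<omega> u e" for u z
    by (subst y[of z]) (simp add: \<omega>_simps)
  have "\<omega> (almost_abelian_bracket A x y) z + \<omega> (almost_abelian_bracket A y z) x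
      + \<omega> (almost_abelian_bracket A z x) y = 0" for x y z
    using skew'[of x y] skew'[of y z] skew'[of z x]
    by (simp add: bracket \<omega>_simps expand[of _ x] expand[of _ y] expand[of _ z] algebra_simps)
  then show ?thesis
    using bil alt nondeg by (auto simp: symplectic_structure_def)
qed

theorem theorem5p13:
  fixes A :: "real^'d^'d" and n :: nat
  assumes "CARD('d) = 2 * n - 1"
    and "nilpotent_matrix A"
    and "\<exists>j. complex_structure (almost_abelian_bracket A) j"
  shows "\<exists>\<omega>. symplectic_structure (almost_abelian_bracket A) \<omega>"
proof -
  obtain j where "complex_structure (almost_abelian_bracket A) j"
    using assms(3) by blast
  then obtain e :: "real \<times> (real^'d)" and N where e: "fst e = 1" and N: "complex_linear_endomorphism N j"
    and N_V: "\<And>v. fst v = 0 \<Longrightarrow> N v = (0, A *v snd v)"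
    and span: "\<And>y. \<exists>u v. fst u = 0 \<and> fst v = 0 \<and> y = u + j v"
    by (rule complex_structure_imp_complex_linear_extension) blast
  interpret complex_linear_endomorphism N j
    by (fact N)
  obtain k where k: "(((**) A) ^^ k) (mat 1) = 0"
    using assms(2) by (auto simp: nilpotent_matrix_def)
  have "(N ^^ i) v = (0, (((**) A) ^^ i) (mat 1) *v snd v)" if "fst v = 0" for i v
    using that by (induction i) (simp_all add: N_V prod_eq_iff matrix_vector_mul_assoc)
  then have nil_V: "(N ^^ k) v = 0" if "fst v = 0" for v
    using that k by (simp add: zero_prod_def)
  \<comment> \<open>Nilpotency spreads from the ideal to its sum with its image under
    \<open>j\<close>, as \<open>N\<close> commutes with \<open>j\<close>.\<close>
  have nil: "(N ^^ k) y = 0" for y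
    using span[of y] by (auto simp: pow_simps funpow_j nil_V j_simps)
  obtain \<omega> :: "real \<times> (real^'d) \<Rightarrow> real \<times> (real^'d) \<Rightarrow> real"
    where bil: "bilinear \<omega>" and alt: "\<And>y. \<omega> y y = 0"
      and skew: "\<And>y z. \<omega> (N y) z + \<omega> y (N z) = 0"
      and nondeg: "\<And>y. (\<And>z. \<omega> y z = 0) \<Longrightarrow> y = 0"
    using exists_skew_form_on[of UNIV k] nil by auto
  have "\<omega> (0, A *v snd v) w + \<omega> v (0, A *v snd w) = 0" if "fst v = 0" "fst w = 0" for v w
    using skew[of v w] that by (simp add: N_V)
  then have "symplectic_structure (almost_abelian_bracket A) \<omega>"
    using symplectic_structure_of_skew_form[OF bil alt nondeg e] by blast
  then show ?thesis
    by blast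
qed

end
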